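(* Let $n\ge 1$ and define $j_{\mathrm{Sp}}:\mathrm{GL}(2n,\mathbb{R})\to\mathfrak{sp}(2n,\mathbb{R})$ and $j_{\mathrm{O}}:\mathrm{GL}(2n,\mathbb{R})\to\mathfrak{o}(2n)$ by $j_{\mathrm{Sp}}(E)=-EE^\top\mathbb{J}$ and $j_{\mathrm{O}}(E)=-E^\top\mathbb{J}E$. Then: (i) the left $\mathrm{Sp}(2n,\mathbb{R})$-action on $\mathrm{GL}(2n,\mathbb{R})$ acts transitively on the fibres of $j_{\mathrm{O}}$, i.e. $j_{\mathrm{O}}^{-1}(j_{\mathrm{O}}(E))=\mathrm{Sp}(2n,\mathbb{R})\cdot E$ for every $E\in\mathrm{GL}(2n,\mathbb{R})$; (ii) the right $\mathrm{O}(2n)$-action on $\mathrm{GL}(2n,\mathbb{R})$ acts transitively on the fibres of $j_{\mathrm{Sp}}$, i.e. $j_{\mathrm{Sp}}^{-1}(j_{\mathrm{Sp}}(E))=E\cdot\mathrm{O}(2n)$ for every $E\in\mathrm{GL}(2n,\mathbb{R})$.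
   Context: $\mathbb{J}=\begin{bmatrix}0_n & I_n\\ -I_n & 0_n\end{bmatrix}$; $\mathrm{Sp}(2n,\mathbb{R})=\{S\in\mathrm{GL}(2n,\mathbb{R}) : S^\top\mathbb{J}S=\mathbb{J}\}$ acts on $\mathrm{GL}(2n,\mathbb{R})$ by left multiplication $E\mapsto SE$; $\mathrm{O}(2n)$ acts by right multiplication $E\mapsto EO$. $\mathfrak{sp}(2n,\mathbb{R})=\{\zeta : \zeta^\top\mathbb{J}+\mathbb{J}\zeta=0\}$ and $\mathfrak{o}(2n)=\{\xi : \xi^\top=-\xi\}$ (real $2n\times 2n$ matrices). *)

theory Defs
  imports "HOL-Analysis.Analysis"
begin

text \<open>
  With \<open>CARD('n) = n\<close>, real matrices of size \<open>2n\<close> are indexed by the sum type \<open>'n + 'n\<close>: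
  \<open>Inl\<close> selects the first and \<open>Inr\<close> the second block of \<open>n\<close> coordinates.
\<close>

type_synonym 'n mat2 = "real ^ ('n + 'n) ^ ('n + 'n)"

definition block_mat ::
  "real ^ 'n ^ 'n \<Rightarrow> real ^ 'n ^ 'n \<Rightarrow> real ^ 'n ^ 'n \<Rightarrow> real ^ 'n ^ 'n \<Rightarrow> ('n::finite) mat2" where
  "block_mat A B C D = (\<chi> i j. case i of
      Inl k \<Rightarrow> (case j of Inl l \<Rightarrow> A $ k $ l | Inr l \<Rightarrow> B $ k $ l)
    | Inr k \<Rightarrow> (case j of Inl l \<Rightarrow> C $ k $ l | Inr l \<Rightarrow> D $ k $ l))"

definition JJ :: "('n::finite) mat2" where
  "JJ = block_mat 0 (mat 1) (- mat 1) 0"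

definition GL :: "('n::finite) mat2 set" where
  "GL = {E. invertible E}"

definition Sp :: "('n::finite) mat2 set" where
  "Sp = {S \<in> GL. transpose S ** JJ ** S = JJ}"

definition Orth :: "('n::finite) mat2 set" where
  "Orth = {Q. orthogonal_matrix Q}"

definition sp_alg :: "('n::finite) mat2 set" where
  "sp_alg = {\<zeta>. transpose \<zeta> ** JJ + JJ ** \<zeta> = 0}"

definition o_alg :: "('n::finite) mat2 set" where
  "o_alg = {\<xi>. transpose \<xi> = - \<xi>}"

text \<open>
  The maps below are only meant on \<^const>\<open>GL\<close>; fibres are therefore taken inside \<^const>\<open>GL\<close>.
\<close>

definition j_Sp :: "('n::finite) mat2 \<Rightarrow> 'n mat2" where
  "j_Sp E = - (E ** transpose E ** JJ)"

definition j_O :: "('n::finite) mat2 \<Rightarrow> 'n mat2" where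
  "j_O E = - (transpose E ** JJ ** E)"

definition GL_fibre :: "(('n::finite) mat2 \<Rightarrow> 'n mat2) \<Rightarrow> 'n mat2 \<Rightarrow> 'n mat2 set" where
  "GL_fibre j \<mu> = {F \<in> GL. j F = \<mu>}"

definition Sp_orbit :: "('n::finite) mat2 \<Rightarrow> 'n mat2 set" where
  "Sp_orbit E = (\<lambda>S. S ** E) ` Sp"

definition O_orbit :: "('n::finite) mat2 \<Rightarrow> 'n mat2 set" where
  "O_orbit E = (\<lambda>Q. E ** Q) ` Orth"

end

theory Submission
  imports Defs
begin

text \<open>Up to sign, \<open>j_O E\<close> is the pullback of the bilinear form \<open>JJ\<close>
  along \<open>E\<close>. Two invertible matrices E and F pull \<open>JJ\<close> back to the same
  form exactly when F E^{-1} preserves \<open>JJ\<close>, that is, when it is symplectic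
  (\<open>GL_fibre_j_O\<close>). Since \<open>JJ\<close> is invertible, \<open>j_Sp E\<close>
  carries the same information as the Gram matrix E E^T (\<open>j_Sp_eq_iff\<close>), and E, F share
  it exactly when E^{-1} F is orthogonal (\<open>GL_fibre_j_Sp\<close>).\<close>

lemma matrix_mult_uminus_left: "(- A) ** B = - (A ** (B :: 'a::ring_1 ^ 'p ^ 'n))"
  by (simp add: matrix_matrix_mult_def vec_eq_iff sum_negf)

lemma matrix_mult_uminus_right: "A ** (- B) = - (A ** (B :: 'a::ring_1 ^ 'p ^ 'n))"
  by (simp add: matrix_matrix_mult_def vec_eq_iff sum_negf)

lemma transpose_uminus: "transpose (- A) = - transpose (A :: 'a::group_add ^ 'm ^ 'n)"
  by (simp add: transpose_def vec_eq_iff)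

lemma transpose_JJ: "transpose JJ = - JJ"
  by (auto simp: JJ_def block_mat_def transpose_def vec_eq_iff mat_def split: sum.split)

lemma JJ_mult_JJ: "JJ ** JJ = - mat 1"
proof -
  \<comment> \<open>Checked in each of the four blocks: \<open>sum.Plus\<close> splits the inner sum
    over the two copies of the index type, and the identity blocks reduce each half to at most one
    term.\<close>
  have "(JJ ** JJ) $ i $ j = (- mat 1) $ i $ j" for i j :: "'a + 'a"
    by (cases i; cases j)
      (simp_all add: JJ_def block_mat_def matrix_matrix_mult_def mat_def sum.Plus
        if_distrib [of "\<lambda>x. x * _"] if_distrib [of uminus]
        flip: UNIV_Plus_UNIV cong: if_cong)
  then show ?thesis
    by (simp add: vec_eq_iff)
qed

text \<open>Multiplying by \<open>JJ\<close> once more turns both sides into negatives, because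
  \<open>JJ\<close> squares to minus the identity.\<close>

lemma matrix_mult_JJ_cancel_right: "A ** JJ = B ** JJ \<longleftrightarrow> A = B"
  by (metis JJ_mult_JJ matrix_mul_assoc matrix_mul_rid matrix_mult_uminus_right neg_equal_iff_equal)

text \<open>As E E^T is symmetric and \<open>JJ\<close> is skew, the two summands in the defining
  equation are J E E^T J and its negative.\<close>

lemma j_Sp_in_sp_alg: "j_Sp E \<in> sp_alg"
  by (simp add: sp_alg_def j_Sp_def matrix_transpose_mul transpose_JJ transpose_uminus
      matrix_mult_uminus_left matrix_mult_uminus_right matrix_mul_assoc)

text \<open>Congruence by E keeps the skew matrix \<open>JJ\<close> skew.\<close>

lemma j_O_in_o_alg: "j_O E \<in> o_alg"
  by (simp add: o_alg_def j_O_def matrix_transpose_mul transpose_JJ transpose_uminus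
      matrix_mult_uminus_left matrix_mult_uminus_right matrix_mul_assoc)

lemma j_O_eq_iff: "j_O F = j_O E \<longleftrightarrow> transpose F ** JJ ** F = transpose E ** JJ ** E"
  by (simp add: j_O_def)

lemma j_Sp_eq_iff: "j_Sp F = j_Sp E \<longleftrightarrow> F ** transpose F = E ** transpose E"
  by (simp add: j_Sp_def matrix_mult_JJ_cancel_right)

lemma GL_fibre_j_O:
  assumes "E \<in> GL"
  shows "GL_fibre j_O (j_O E) = Sp_orbit E"
proof (intro set_eqI iffI)
  obtain E' where E': "E ** E' = mat 1" "E' ** E = mat 1"
    using assms by (auto simp: GL_def invertible_def)
  fix F assume "F \<in> GL_fibre j_O (j_O E)"
  then have F: "invertible F" "transpose F ** JJ ** F = transpose E ** JJ ** E"
    by (simp_all add: GL_fibre_def GL_def j_O_eq_iff)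
  \<comment> \<open>The equation F = S E forces S = F E^{-1}; it remains to see that this S is
    symplectic.\<close>
  have "transpose (F ** E') ** JJ ** (F ** E') = transpose E' ** (transpose F ** JJ ** F) ** E'"
    by (simp add: matrix_transpose_mul matrix_mul_assoc)
  also have "\<dots> = transpose (E ** E') ** JJ ** (E ** E')"
    unfolding F by (simp add: matrix_transpose_mul matrix_mul_assoc)
  also have "\<dots> = JJ"
    by (simp add: E')
  finally have "transpose (F ** E') ** JJ ** (F ** E') = JJ" .
  moreover have "invertible E'"
    using E' by (auto simp: invertible_def)
  ultimately have "F ** E' \<in> Sp"
    using F(1) by (simp add: Sp_def GL_def invertible_mult)
  moreover have "F = (F ** E') ** E"
    by (simp add: E' flip: matrix_mul_assoc)
  ultimately show "F \<in> Sp_orbit E"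
    unfolding Sp_orbit_def by blast
next
  fix F assume "F \<in> Sp_orbit E"
  then obtain S where S: "invertible S" "transpose S ** JJ ** S = JJ" "F = S ** E"
    by (auto simp: Sp_orbit_def Sp_def GL_def)
  \<comment> \<open>Regrouping isolates S^T J S, which collapses to \<open>JJ\<close>.\<close>
  have "transpose F ** JJ ** F = transpose E ** (transpose S ** JJ ** S) ** E"
    by (simp add: S(3) matrix_transpose_mul matrix_mul_assoc)
  then show "F \<in> GL_fibre j_O (j_O E)"
    using assms S by (simp add: GL_fibre_def GL_def j_O_eq_iff invertible_mult)
qed

lemma GL_fibre_j_Sp:
  assumes "E \<in> GL"
  shows "GL_fibre j_Sp (j_Sp E) = O_orbit E"
proof (intro set_eqI iffI)
  obtain E' where E': "E ** E' = mat 1" "E' ** E = mat 1"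
    using assms by (auto simp: GL_def invertible_def)
  fix F assume "F \<in> GL_fibre j_Sp (j_Sp E)"
  then have F: "F ** transpose F = E ** transpose E"
    by (simp add: GL_fibre_def j_Sp_eq_iff)
  have "(E' ** F) ** transpose (E' ** F) = E' ** (F ** transpose F) ** transpose E'"
    by (simp add: matrix_transpose_mul matrix_mul_assoc)
  also have "\<dots> = (E' ** E) ** transpose (E' ** E)"
    unfolding F by (simp add: matrix_transpose_mul matrix_mul_assoc)
  also have "\<dots> = mat 1"
    by (simp add: E')
  \<comment> \<open>The chain gives only Q Q^T = 1 for Q = E^{-1} F; for square matrices a one-sided
    inverse is two-sided, so Q^T Q = 1 as well.\<close>
  finally have "E' ** F \<in> Orth"
    by (simp add: Orth_def orthogonal_matrix_def matrix_left_right_inverse)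
  moreover have "F = E ** (E' ** F)"
    by (simp add: E' matrix_mul_assoc)
  ultimately show "F \<in> O_orbit E"
    unfolding O_orbit_def by blast
next
  fix F assume "F \<in> O_orbit E"
  then obtain Q where Q: "orthogonal_matrix Q" "F = E ** Q"
    by (auto simp: O_orbit_def Orth_def)
  have "F ** transpose F = E ** (Q ** transpose Q) ** transpose E"
    by (simp add: Q(2) matrix_transpose_mul matrix_mul_assoc)
  \<comment> \<open>The fibre is taken inside \<open>GL\<close>, so E Q must also be shown
    invertible.\<close>
  moreover have "invertible Q"
    using Q(1) by (auto simp: orthogonal_matrix_def invertible_def)
  ultimately show "F \<in> GL_fibre j_Sp (j_Sp E)"
    using assms Q by (simp add: GL_fibre_def GL_def j_Sp_eq_iff invertible_mult orthogonal_matrix_def)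
qed

theorem proposition4p1:
  shows "j_Sp \<in> (GL :: ('n::finite) mat2 set) \<rightarrow> sp_alg \<and>
    j_O \<in> (GL :: 'n mat2 set) \<rightarrow> o_alg \<and>
    (\<forall>E \<in> (GL :: 'n mat2 set). GL_fibre j_O (j_O E) = Sp_orbit E) \<and>
    (\<forall>E \<in> (GL :: 'n mat2 set). GL_fibre j_Sp (j_Sp E) = O_orbit E)"
  by (simp add: j_Sp_in_sp_alg j_O_in_o_alg GL_fibre_j_O GL_fibre_j_Sp)

end
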